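(* Let $R=(R(t))_{t\ge 0}$ be a risk reserve process with $R(0)=u>0$ satisfying conditions (i) and (ii) of the context, and assume that the random variables $Y_k:=R(T_{k-1})-R(T_k)$, $k=1,2,\ldots$, are mutually independent. Let $S_k:=Y_1+\cdots+Y_k$. Then for any $u>0$ the ruin probability $\psi(u)$ satisfies $$\psi(u)\le\inf_{h\in[0,L(Y_\bullet)]}\big\{e^{-hu}\mathbf{E}e^{hY_1}\big\}\le e^{-L(Y_\bullet)u}\,\mathbf{E}e^{L(Y_\bullet)Y_1}\le e^{-L(Y_\bullet)u},$$ with $$L(Y_\bullet):=\sup\Big\{h\ge0:\ \sup_{j\ge1}\mathbf{E}e^{hY_j}\le1\Big\}\le L(S_\bullet),\qquad\text{where}\quad L(S_\bullet):=\sup\Big\{h\ge0:\ \sup_{k\ge1}\mathbf{E}e^{hS_k}\le1\Big\}.$$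
   Context: $R(t)$, $t\ge 0$, is a risk reserve process (a real-valued stochastic process) with non-random initial reserve $R(0)=u>0$. The ultimate ruin probability is $\psi(u):=\mathbf{P}[\inf_{t\ge 0}R(t)<0\mid R(0)=u]$. Conditions: (i) The process $R(t)$ may have positive jumps only at random or non-random times $T_1,T_2,\ldots$ such that $T_{k+1}>T_k>T_0:=0$ for all $k=1,2,\ldots$ and $T_n\to\infty$ almost surely. (ii) The process $R(t)$ is monotone on each time interval $[T_{k-1},T_k)$, $k=1,2,\ldots$, and $R(0)=u>0$. Convention: expectations $\mathbf{E}e^{hS}$ with $h\ge0$ take values in $(0,\infty]$.
   Formalization: Adds the assumption that if R has a positive jump at T_k then R is nondecreasing on [T_{k-1},T_k); without it the claim fails, e.g. T_k=k, R(t)=u+k-2(t-k) on [k,k+1), u<2, where Y_k=-1 and the bound is 0 but ruin is certain. *)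

theory Defs
  imports "HOL-Probability.Probability"
begin

(* The extended exponential, needed because the Lundberg exponent below may be infinite. *)
definition exp_ereal :: "ereal \<Rightarrow> ennreal" where
  "exp_ereal x =
     (if x = \<infinity> then \<infinity> else if x = -\<infinity> then 0 else ennreal (exp (real_of_ereal x)))"

(* E exp(h X), possibly infinite.  For h = \<infinity> this uses the convention \<infinity> * 0 = 0 of type ereal, so the
   integrand is 0, 1 or \<infinity> according to the sign of X. *)
definition exp_moment :: "'a measure \<Rightarrow> ereal \<Rightarrow> ('a \<Rightarrow> real) \<Rightarrow> ennreal" where
  "exp_moment M h X = (\<integral>\<^sup>+ \<omega>. exp_ereal (h * ereal (X \<omega>)) \<partial>M)"

(* The supremum ranges over finite h only, but may itself be infinite. *)
definition lundberg_exponent :: "'a measure \<Rightarrow> (nat \<Rightarrow> 'a \<Rightarrow> real) \<Rightarrow> ereal" where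
  "lundberg_exponent M X =
     Sup (ereal ` {h. 0 \<le> h \<and> (SUP j\<in>{1..}. exp_moment M (ereal h) (X j)) \<le> 1})"

(* f(t) > f(t-), with the left limit taken in the extended reals: a monotone path may diverge
   as t is approached from the left. *)
definition positive_jump :: "(real \<Rightarrow> real) \<Rightarrow> real \<Rightarrow> bool" where
  "positive_jump f t \<longleftrightarrow> (\<exists>l. ((\<lambda>s. ereal (f s)) \<longlongrightarrow> l) (at_left t) \<and> l < ereal (f t))"

(* The infimum runs over uncountably many times, so the ruin event need not belong to the
   sigma-algebra of M itself; hence the probability is taken in the completion of M. *)
definition ruin_prob :: "'a measure \<Rightarrow> (real \<Rightarrow> 'a \<Rightarrow> real) \<Rightarrow> real \<Rightarrow> real" where
  "ruin_prob M R u =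
     \<P>(\<omega> in completion M. (INF t\<in>{0..}. ereal (R t \<omega>)) < 0 \<bar> R 0 \<omega> = u)"

definition loss :: "(real \<Rightarrow> 'a \<Rightarrow> real) \<Rightarrow> (nat \<Rightarrow> 'a \<Rightarrow> real) \<Rightarrow> nat \<Rightarrow> 'a \<Rightarrow> real" where
  "loss R T k \<omega> = R (T (k - 1) \<omega>) \<omega> - R (T k \<omega>) \<omega>"

definition total_loss :: "(real \<Rightarrow> 'a \<Rightarrow> real) \<Rightarrow> (nat \<Rightarrow> 'a \<Rightarrow> real) \<Rightarrow> nat \<Rightarrow> 'a \<Rightarrow> real" where
  "total_loss R T k \<omega> = (\<Sum>i=1..k. loss R T i \<omega>)"

end

theory Submission
  imports Defs
begin

text \<open>
  On each interval between consecutive times \<open>T\<^sub>k\<close> the reserve is at least its value at one of the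
  two endpoints, so ruin forces some partial sum \<open>S\<^sub>k\<close> to exceed \<open>u\<close>.  If \<open>E exp (h Y\<^sub>j) \<le> 1\<close> for
  every \<open>j\<close>, then \<open>exp (h S\<^sub>k)\<close> is a supermartingale; stopping it when \<open>S\<close> first exceeds \<open>u\<close> and
  applying Markov's inequality bounds the ruin probability by \<open>exp (- h u) E exp (h Y\<^sub>1)\<close>.
  The admissible \<open>h\<close> form an interval by convexity of the exponential, closed by Fatou's lemma.
  If \<open>L = \<infinity>\<close>, letting \<open>h\<close> tend to infinity shows that the ruin probability vanishes.
\<close>

section \<open>Paths: the values at the times \<open>T k\<close> bound the reserve from
  below\<close>

lemma antimono_on_no_positive_jump:
  fixes f :: "real \<Rightarrow> real"
  assumes anti: "antimono_on {a..<b} f" and nojump: "\<not> positive_jump f b" and t: "t \<in> {a..<b}"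
  shows "f b \<le> f t"
proof (rule ccontr)
  assume "\<not> f b \<le> f t"
  then have less: "f t < f b" by simp
  \<comment> \<open>A decreasing path converges from the left to its infimum, possibly -\<infinity>.
    As \<open>l \<le> f t < f b\<close>, this limit would witness a positive jump at
    \<open>b\<close>.\<close>
  define l where "l = (INF s\<in>{a..<b}. ereal (f s))"
  have "((\<lambda>s. ereal (f s)) \<longlongrightarrow> l) (at_left b)"
  proof (rule order_tendstoI)
    fix c assume "c < l"
    have "eventually (\<lambda>s. s \<in> {a<..<b}) (at_left b)"
      using t by (intro eventually_at_leftI[of a]) auto
    then show "eventually (\<lambda>s. c < ereal (f s)) (at_left b)"
    proof eventually_elim
      case (elim s)
      then have "l \<le> ereal (f s)" unfolding l_def by (intro INF_lower) auto
      with \<open>c < l\<close> show ?case by simp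
    qed
  next
    fix c assume "l < c"
    then obtain r where r: "r \<in> {a..<b}" "ereal (f r) < c"
      unfolding l_def INF_less_iff by auto
    have "eventually (\<lambda>s. s \<in> {r<..<b}) (at_left b)"
      using r by (intro eventually_at_leftI[of r]) auto
    then show "eventually (\<lambda>s. ereal (f s) < c) (at_left b)"
    proof eventually_elim
      case (elim s)
      then have "f s \<le> f r"
        using anti r by (auto simp: monotone_on_def)
      then have "ereal (f s) \<le> ereal (f r)" by simp
      with r(2) show ?case by (rule le_less_trans[rotated])
    qed
  qed
  moreover have "l < ereal (f b)"
  proof -
    have "l \<le> ereal (f t)" unfolding l_def using t by (rule INF_lower)
    with less show ?thesis by (simp add: le_less_trans)
  qed
  ultimately show False
    using nojump unfolding positive_jump_def by blast
qed

text \<open>The time \<open>t\<close> lies in some interval from \<open>\<tau> k\<close> to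
  \<open>\<tau> (Suc k)\<close>. An increasing path is lowest at the left endpoint; a decreasing one
  cannot jump up at the right endpoint, by \<open>jump\<close>, so the value there is a lower
  bound.\<close>

lemma path_bounded_below_at_jump_times:
  fixes f :: "real \<Rightarrow> real" and \<tau> :: "nat \<Rightarrow> real"
  assumes zero: "\<tau> 0 = 0" and lim: "filterlim \<tau> at_top sequentially"
    and mono: "\<And>k. mono_on {\<tau> k..<\<tau> (Suc k)} f \<or> antimono_on {\<tau> k..<\<tau> (Suc k)} f"
    and jump: "\<And>k. positive_jump f (\<tau> (Suc k)) \<Longrightarrow> mono_on {\<tau> k..<\<tau> (Suc k)} f"
    and t: "0 \<le> t"
  shows "\<exists>k. f (\<tau> k) \<le> f t"
proof -
  have "eventually (\<lambda>n. t < \<tau> n) sequentially"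
    using lim by (simp add: filterlim_at_top_dense)
  then have ex: "\<exists>n. t < \<tau> n"
    by (auto simp: eventually_sequentially)
  \<comment> \<open>Minimality of \<open>n\<close> gives \<open>\<tau> (n - 1) \<le> t\<close>;
    \<open>n\<close> is positive because \<open>\<tau> 0 = 0 \<le> t\<close>.\<close>
  define n where "n = (LEAST n. t < \<tau> n)"
  have n: "t < \<tau> n" unfolding n_def using ex by (rule LeastI_ex)
  with zero t have "n \<noteq> 0" by (cases "n = 0") auto
  then obtain k where k: "n = Suc k" using not0_implies_Suc by blast
  have "\<not> t < \<tau> k"
    using not_less_Least[of k "\<lambda>n. t < \<tau> n"] k unfolding n_def by simp
  with n k have in_k: "t \<in> {\<tau> k..<\<tau> (Suc k)}" by simp
  show ?thesis
  proof (cases "mono_on {\<tau> k..<\<tau> (Suc k)} f")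
    case True
    with in_k have "f (\<tau> k) \<le> f t" by (auto simp: monotone_on_def)
    then show ?thesis ..
  next
    case False
    with mono jump in_k have "f (\<tau> (Suc k)) \<le> f t"
      by (intro antimono_on_no_positive_jump[of "\<tau> k"]) auto
    then show ?thesis ..
  qed
qed

section \<open>Telescoping losses, exponential moments and products of independent variables\<close>

lemma total_loss_telescope: "total_loss R T k \<omega> = R (T 0 \<omega>) \<omega> - R (T k \<omega>) \<omega>"
  by (induction k) (simp_all add: total_loss_def loss_def)

lemma exp_moment_ereal: "exp_moment M (ereal h) X = (\<integral>\<^sup>+ \<omega>. ennreal (exp (h * X \<omega>)) \<partial>M)"
  by (simp add: exp_moment_def exp_ereal_def)

lemma (in prob_space) indep_var_nn_integral_mult:
  fixes X Y :: "'a \<Rightarrow> ennreal"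
  assumes "indep_var borel X borel Y"
  shows "(\<integral>\<^sup>+ \<omega>. X \<omega> * Y \<omega> \<partial>M) = (\<integral>\<^sup>+ \<omega>. X \<omega> \<partial>M) * (\<integral>\<^sup>+ \<omega>. Y \<omega> \<partial>M)"
proof -
  \<comment> \<open>A pair is a family indexed by \<open>bool\<close>; with a constant target space
    the product formula for finite independent families applies.\<close>
  have "case_bool borel borel = (\<lambda>_. borel :: ennreal measure)"
    by (simp add: fun_eq_iff split: bool.split)
  with assms have "indep_vars (\<lambda>_. borel) (case_bool X Y) UNIV"
    by (simp add: indep_var_def)
  from indep_vars_nn_integral[OF _ this] show ?thesis
    by (simp add: UNIV_bool mult.commute)
qed

section \<open>Stopped partial sums and the maximal inequality\<close>

primrec stopped_sum :: "real \<Rightarrow> (nat \<Rightarrow> real) \<Rightarrow> nat \<Rightarrow> real" where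
  "stopped_sum u y 0 = 0"
| "stopped_sum u y (Suc n) =
     (if u < stopped_sum u y n then stopped_sum u y n else stopped_sum u y n + y (Suc n))"

text \<open>Lets the stopped sum be evaluated on the restriction of the losses to
  \<open>{1..n}\<close>, the form in which independence of disjoint blocks is stated.\<close>

lemma stopped_sum_cong:
  assumes "\<And>i. i \<in> {1..n} \<Longrightarrow> x i = y i"
  shows "stopped_sum u x n = stopped_sum u y n"
  using assms by (induction n) auto

text \<open>The recursion freezes at the first value above \<open>u\<close>, so a final value at
  most \<open>u\<close> shows that it never froze. The contrapositive detects every crossing up to
  \<open>n\<close> from the final value alone.\<close>

lemma stopped_sum_eq_sum:
  assumes "stopped_sum u y n \<le> u"
  shows "stopped_sum u y n = (\<Sum>i=1..n. y i) \<and> (\<forall>k\<le>n. (\<Sum>i=1..k. y i) \<le> u)"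
  using assms
proof (induction n)
  case (Suc n)
  then have le: "stopped_sum u y n \<le> u" by (auto split: if_splits)
  with Suc show ?case by (auto simp: le_Suc_eq)
qed auto

lemma measurable_stopped_sum:
  assumes "\<And>i. i \<in> {1..n} \<Longrightarrow> (\<lambda>\<omega>. X \<omega> i) \<in> borel_measurable N"
  shows "(\<lambda>\<omega>. stopped_sum u (X \<omega>) n) \<in> borel_measurable N"
  using assms
proof (induction n)
  case (Suc n)
  then have [measurable]: "(\<lambda>\<omega>. stopped_sum u (X \<omega>) n) \<in> borel_measurable N"
    "(\<lambda>\<omega>. X \<omega> (Suc n)) \<in> borel_measurable N" by auto
  show ?case by simp
qed simp

text \<open>Once above \<open>u\<close> the sum no longer moves; before that, the new factor exp (h
  Y) is independent of the past and has mean at most 1. Comparing plain expectations avoids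
  conditional ones.\<close>

lemma (in prob_space) stopped_sum_supermartingale:
  fixes Y :: "nat \<Rightarrow> 'a \<Rightarrow> real"
  assumes indep: "indep_vars (\<lambda>_. borel) Y {1..}"
    and moment: "exp_moment M (ereal h) (Y (Suc n)) \<le> 1"
  shows "exp_moment M (ereal h) (\<lambda>\<omega>. stopped_sum u (\<lambda>i. Y i \<omega>) (Suc n))
       \<le> exp_moment M (ereal h) (\<lambda>\<omega>. stopped_sum u (\<lambda>i. Y i \<omega>) n)"
proof -
  define Z where "Z \<omega> = stopped_sum u (\<lambda>i. Y i \<omega>) n" for \<omega>
  define e where "e x = ennreal (exp (h * x))" for x
  \<comment> \<open>\<open>A\<close> carries the stopped paths and \<open>B\<close> the running
    ones, with \<open>A x + B x = e x\<close>; only \<open>B\<close> is multiplied by the new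
    factor.\<close>
  define A where "A x = (if u < x then e x else 0)" for x
  define B where "B x = (if u < x then 0 else e x)" for x
  have Y [measurable]: "Y i \<in> borel_measurable M" if "1 \<le> i" for i
    using indep that unfolding indep_vars_def by auto
  have Y_Suc [measurable]: "Y (Suc n) \<in> borel_measurable M" by (rule Y) simp
  have Z [measurable]: "Z \<in> borel_measurable M"
    unfolding Z_def by (rule measurable_stopped_sum) auto
  have e [measurable]: "e \<in> borel_measurable borel" unfolding e_def by measurable
  have A [measurable]: "A \<in> borel_measurable borel" unfolding A_def by measurable
  have B [measurable]: "B \<in> borel_measurable borel" unfolding B_def by measurable
  \<comment> \<open>One factor is a function of the coordinates \<open>{1..n}\<close>, the other of
    the coordinate \<open>Suc n\<close>: disjoint blocks of an independent family.\<close>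
  have "indep_var borel
      ((\<lambda>y. B (stopped_sum u y n)) \<circ> (\<lambda>\<omega>. restrict (\<lambda>i. Y i \<omega>) {1..n}))
      borel ((\<lambda>y. e (y (Suc n))) \<circ> (\<lambda>\<omega>. restrict (\<lambda>i. Y i \<omega>) {Suc n}))"
  proof (rule indep_var_compose[OF indep_var_restrict[OF indep]])
    have "(\<lambda>y. stopped_sum u y n) \<in> borel_measurable (PiM {1..n} (\<lambda>_. borel))"
      by (rule measurable_stopped_sum) simp
    then show "(\<lambda>y. B (stopped_sum u y n)) \<in> borel_measurable (PiM {1..n} (\<lambda>_. borel))"
      by measurable
  qed (auto intro!: measurable_compose[OF _ e] measurable_component_singleton)
  moreover have "stopped_sum u (restrict (\<lambda>i. Y i \<omega>) {1..n}) n = Z \<omega>" for \<omega>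
    unfolding Z_def by (rule stopped_sum_cong) auto
  ultimately have "indep_var borel (\<lambda>\<omega>. B (Z \<omega>)) borel (\<lambda>\<omega>. e (Y (Suc n) \<omega>))"
    by (simp add: comp_def)
  note prod = indep_var_nn_integral_mult[OF this]
  have step: "e (stopped_sum u (\<lambda>i. Y i \<omega>) (Suc n)) = A (Z \<omega>) + B (Z \<omega>) * e (Y (Suc n) \<omega>)" for \<omega>
    by (simp add: A_def B_def e_def Z_def distrib_left exp_add ennreal_mult)
  have "exp_moment M (ereal h) (\<lambda>\<omega>. stopped_sum u (\<lambda>i. Y i \<omega>) (Suc n)) =
      (\<integral>\<^sup>+ \<omega>. A (Z \<omega>) + B (Z \<omega>) * e (Y (Suc n) \<omega>) \<partial>M)"
    unfolding exp_moment_ereal e_def[symmetric] step ..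
  also have "\<dots> = (\<integral>\<^sup>+ \<omega>. A (Z \<omega>) \<partial>M) + (\<integral>\<^sup>+ \<omega>. B (Z \<omega>) \<partial>M) * (\<integral>\<^sup>+ \<omega>. e (Y (Suc n) \<omega>) \<partial>M)"
    by (subst nn_integral_add) (simp_all add: prod)
  also have "\<dots> \<le> (\<integral>\<^sup>+ \<omega>. A (Z \<omega>) \<partial>M) + (\<integral>\<^sup>+ \<omega>. B (Z \<omega>) \<partial>M) * 1"
    using moment by (intro add_mono mult_mono) (auto simp: exp_moment_ereal e_def)
  also have "\<dots> = (\<integral>\<^sup>+ \<omega>. A (Z \<omega>) + B (Z \<omega>) \<partial>M)"
    by (subst nn_integral_add) simp_all
  also have "\<dots> = exp_moment M (ereal h) Z"
    unfolding exp_moment_ereal by (intro nn_integral_cong) (auto simp: A_def B_def e_def)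
  finally show ?thesis unfolding Z_def .
qed

lemma (in prob_space) partial_sums_exceed_le:
  fixes Y :: "nat \<Rightarrow> 'a \<Rightarrow> real"
  assumes indep: "indep_vars (\<lambda>_. borel) Y {1..}"
    and h: "0 \<le> h" and u: "0 \<le> u"
    and moment: "\<And>j. 2 \<le> j \<Longrightarrow> exp_moment M (ereal h) (Y j) \<le> 1"
  shows "emeasure M {\<omega> \<in> space M. \<exists>k. u < (\<Sum>i=1..k. Y i \<omega>)}
       \<le> ennreal (exp (- (h * u))) * exp_moment M (ereal h) (Y 1)"
proof -
  define Z where "Z n \<omega> = stopped_sum u (\<lambda>i. Y i \<omega>) n" for n \<omega>
  define A where "A n = {\<omega> \<in> space M. \<exists>k\<le>n. u < (\<Sum>i=1..k. Y i \<omega>)}" for n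
  have Y [measurable]: "Y i \<in> borel_measurable M" if "1 \<le> i" for i
    using indep that unfolding indep_vars_def by auto
  have Z [measurable]: "Z n \<in> borel_measurable M" for n
    unfolding Z_def by (rule measurable_stopped_sum) auto
  have sum [measurable]: "(\<lambda>\<omega>. \<Sum>i=1..k. Y i \<omega>) \<in> borel_measurable M" for k
    by (rule borel_measurable_sum) auto
  have A [measurable]: "A n \<in> sets M" for n
    unfolding A_def by measurable
  \<comment> \<open>The descent stops at \<open>Z 1\<close>, which is \<open>Y 1\<close> since
    \<open>u\<close> is nonnegative. Hence the moment of \<open>Y 1\<close> stays in the bound and
    \<open>moment\<close> is invoked only from index 2 on.\<close>
  have mom: "exp_moment M (ereal h) (Z (Suc n)) \<le> exp_moment M (ereal h) (Y 1)" for n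
  proof (induction n)
    case 0
    then show ?case using u by (simp add: Z_def)
  next
    case (Suc n)
    have "exp_moment M (ereal h) (Z (Suc (Suc n))) \<le> exp_moment M (ereal h) (Z (Suc n))"
      unfolding Z_def by (intro stopped_sum_supermartingale indep moment) simp
    with Suc show ?case by simp
  qed
  have bound: "emeasure M (A (Suc n)) \<le> ennreal (exp (- (h * u))) * exp_moment M (ereal h) (Y 1)" for n
  proof -
    have "A (Suc n) \<subseteq> {\<omega> \<in> space M. 1 \<le> ennreal (exp (- (h * u))) * ennreal (exp (h * Z (Suc n) \<omega>))}"
    proof
      fix \<omega> assume \<omega>: "\<omega> \<in> A (Suc n)"
      then have "u < Z (Suc n) \<omega>"
        using stopped_sum_eq_sum[of u "\<lambda>i. Y i \<omega>" "Suc n"]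
        unfolding A_def Z_def by (force simp del: stopped_sum.simps)
      with h have "h * u \<le> h * Z (Suc n) \<omega>" by (intro mult_left_mono) auto
      then have "1 \<le> exp (- (h * u)) * exp (h * Z (Suc n) \<omega>)"
        by (simp flip: exp_add)
      with \<omega> show "\<omega> \<in> {\<omega> \<in> space M. 1 \<le> ennreal (exp (- (h * u))) * ennreal (exp (h * Z (Suc n) \<omega>))}"
        by (simp add: A_def flip: ennreal_mult)
    qed
    then have "emeasure M (A (Suc n)) \<le>
        emeasure M {\<omega> \<in> space M. 1 \<le> ennreal (exp (- (h * u))) * ennreal (exp (h * Z (Suc n) \<omega>))}"
      by (rule emeasure_mono) measurable
    also have "\<dots> \<le> ennreal (exp (- (h * u))) *
        (\<integral>\<^sup>+ \<omega>. ennreal (exp (h * Z (Suc n) \<omega>)) * indicator (space M) \<omega> \<partial>M)"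
      by (rule nn_integral_Markov_inequality) measurable
    also have "(\<integral>\<^sup>+ \<omega>. ennreal (exp (h * Z (Suc n) \<omega>)) * indicator (space M) \<omega> \<partial>M) =
        exp_moment M (ereal h) (Z (Suc n))"
      unfolding exp_moment_ereal by (intro nn_integral_cong) simp
    also have "ennreal (exp (- (h * u))) * \<dots> \<le> ennreal (exp (- (h * u))) * exp_moment M (ereal h) (Y 1)"
      by (intro mult_left_mono mom) simp
    finally show ?thesis .
  qed
  have "{\<omega> \<in> space M. \<exists>k. u < (\<Sum>i=1..k. Y i \<omega>)} = (\<Union>n. A (Suc n))"
    unfolding A_def by (auto intro: le_SucI)
  \<comment> \<open>The events increase with \<open>n\<close> and their bound is uniform, so
    continuity from below passes it to the union.\<close>
  also have "emeasure M \<dots> = (SUP n. emeasure M (A (Suc n)))"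
    by (rule SUP_emeasure_incseq[symmetric]) (auto simp: incseq_def A_def intro: order_trans)
  also have "\<dots> \<le> ennreal (exp (- (h * u))) * exp_moment M (ereal h) (Y 1)"
    by (intro SUP_least bound)
  finally show ?thesis .
qed

section \<open>From ruin in continuous time to a crossing by the partial sums\<close>

lemma (in prob_space) ruin_prob_le_exceed:
  assumes u: "0 < u"
    and R0_meas: "R 0 \<in> borel_measurable M"
    and R0: "AE \<omega> in M. R 0 \<omega> = u" and T0: "AE \<omega> in M. T 0 \<omega> = 0"
    and lim: "AE \<omega> in M. filterlim (\<lambda>n. T n \<omega>) at_top sequentially"
    and mono: "AE \<omega> in M. \<forall>k. mono_on {T k \<omega>..<T (Suc k) \<omega>} (\<lambda>s. R s \<omega>) \<or>
                       antimono_on {T k \<omega>..<T (Suc k) \<omega>} (\<lambda>s. R s \<omega>)"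
    and jump: "AE \<omega> in M. \<forall>k. positive_jump (\<lambda>s. R s \<omega>) (T (Suc k) \<omega>) \<longrightarrow>
                       mono_on {T k \<omega>..<T (Suc k) \<omega>} (\<lambda>s. R s \<omega>)"
    and meas: "\<And>k. 1 \<le> k \<Longrightarrow> loss R T k \<in> borel_measurable M"
  shows "ennreal (ruin_prob M R u) \<le> emeasure M {\<omega> \<in> space M. \<exists>k. u < total_loss R T k \<omega>}"
proof -
  let ?E = "{\<omega> \<in> space M. \<exists>k. u < total_loss R T k \<omega>}"
  let ?C = "completion M"
  interpret C: prob_space ?C by (rule prob_space_completion)
  have [measurable]: "total_loss R T k \<in> borel_measurable M" for k
    unfolding total_loss_def[abs_def] by (rule borel_measurable_sum) (auto intro: meas)
  have E: "?E \<in> sets M" by measurable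
  \<comment> \<open>A negative reserve at some \<open>t\<close> forces a negative one at some
    \<open>T k\<close>. The total loss telescopes to \<open>u - R (T k)\<close> almost surely, so it
    exceeds \<open>u\<close>.\<close>
  have ae: "AE \<omega> in M. (INF t\<in>{0..}. ereal (R t \<omega>)) < 0 \<longrightarrow> (\<exists>k. u < total_loss R T k \<omega>)"
    using R0 T0 lim mono jump
  proof eventually_elim
    case (elim \<omega>)
    show ?case
    proof
      assume "(INF t\<in>{0..}. ereal (R t \<omega>)) < 0"
      then obtain t where t: "0 \<le> t" "R t \<omega> < 0" by (auto simp: INF_less_iff)
      obtain k where "R (T k \<omega>) \<omega> \<le> R t \<omega>"
        using path_bounded_below_at_jump_times[of "\<lambda>k. T k \<omega>" "\<lambda>s. R s \<omega>" t] elim t(1) by auto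
      with t(2) elim(1,2) have "u < total_loss R T k \<omega>"
        by (simp add: total_loss_telescope)
      then show "\<exists>k. u < total_loss R T k \<omega>" ..
    qed
  qed
  \<comment> \<open>The conditioning event has probability 1, so the conditional probability is that
    of the intersection.\<close>
  have "\<P>(\<omega> in M. R 0 \<omega> = u) = 1"
    using R0 R0_meas by (subst prob_Collect_eq_1) auto
  moreover have "{\<omega> \<in> space M. R 0 \<omega> = u} \<in> sets M"
    using R0_meas by measurable
  ultimately have "ruin_prob M R u =
      measure ?C {\<omega> \<in> space M. (INF t\<in>{0..}. ereal (R t \<omega>)) < 0 \<and> R 0 \<omega> = u}"
    unfolding ruin_prob_def cond_prob_def by simp
  \<comment> \<open>Only \<open>?E\<close> must be measurable for this comparison:
    \<open>measure\<close> is 0 by default outside the sigma-algebra.\<close>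
  also have "\<dots> \<le> measure ?C ?E"
  proof (rule C.finite_measure_mono_AE)
    show "AE \<omega> in ?C. \<omega> \<in> {\<omega> \<in> space M. (INF t\<in>{0..}. ereal (R t \<omega>)) < 0 \<and> R 0 \<omega> = u} \<longrightarrow> \<omega> \<in> ?E"
      using AE_completion[OF ae] by eventually_elim auto
  qed (use E in simp)
  also have "\<dots> = measure M ?E" using E by simp
  finally show ?thesis
    by (simp add: emeasure_eq_measure)
qed

section \<open>The set of admissible exponents and its supremum\<close>

lemma mem_lundberg_set_iff:
  "h \<in> {h. 0 \<le> h \<and> (SUP j\<in>{1..}. exp_moment M (ereal h) (X j)) \<le> 1} \<longleftrightarrow>
   0 \<le> h \<and> (\<forall>j\<ge>1. exp_moment M (ereal h) (X j) \<le> 1)"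
  by (auto simp: SUP_le_iff)

text \<open>With \<open>c = h / h'\<close>, the number h x is the convex combination of 0 and h' x
  with weights 1 - c and c. Convexity of exp bounds the moment at \<open>h\<close> by the same
  combination of 1 and the moment at \<open>h'\<close>.\<close>

lemma (in prob_space) exp_moment_le_1_antimono:
  fixes X :: "'a \<Rightarrow> real"
  assumes X [measurable]: "X \<in> borel_measurable M"
    and h: "0 \<le> h" "h < h'" and le: "exp_moment M (ereal h') X \<le> 1"
  shows "exp_moment M (ereal h) X \<le> 1"
proof -
  define c where "c = h / h'"
  have c: "0 \<le> c" "c \<le> 1" using h by (auto simp: c_def)
  have "exp (h * x) \<le> (1 - c) + c * exp (h' * x)" for x
  proof -
    have "exp ((1 - c) *\<^sub>R 0 + c *\<^sub>R (h' * x)) \<le> (1 - c) * exp 0 + c * exp (h' * x)"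
      using c by (intro convex_onD[OF exp_convex]) auto
    moreover have "c * (h' * x) = h * x" using h by (simp add: c_def)
    ultimately show ?thesis by simp
  qed
  then have "exp_moment M (ereal h) X \<le> (\<integral>\<^sup>+ \<omega>. ennreal (1 - c) + ennreal c * ennreal (exp (h' * X \<omega>)) \<partial>M)"
    unfolding exp_moment_ereal using c
    by (intro nn_integral_mono) (simp flip: ennreal_mult ennreal_plus)
  also have "\<dots> = ennreal (1 - c) + ennreal c * exp_moment M (ereal h') X"
    unfolding exp_moment_ereal
    by (subst nn_integral_add) (simp_all add: nn_integral_cmult emeasure_space_1)
  also have "\<dots> \<le> ennreal (1 - c) + ennreal c * 1"
    by (intro add_mono mult_mono le) auto
  also have "\<dots> = 1" using c by (simp flip: ennreal_plus)
  finally show ?thesis .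
qed

text \<open>Below the supremum some larger exponent is admissible and convexity applies. The
  supremum itself, when finite, is reached by a limit from below.\<close>

lemma (in prob_space) exp_moment_le_1_below_lundberg:
  fixes X :: "nat \<Rightarrow> 'a \<Rightarrow> real"
  assumes X: "X j \<in> borel_measurable M" and j: "1 \<le> j"
    and h: "0 \<le> h" "ereal h \<le> lundberg_exponent M X"
  shows "exp_moment M (ereal h) (X j) \<le> 1"
proof (cases "h = 0")
  case True
  then show ?thesis by (simp add: exp_moment_ereal emeasure_space_1)
next
  case False
  note X [measurable]
  have less: "exp_moment M (ereal g) (X j) \<le> 1" if g: "0 \<le> g" "g < h" for g
  proof -
    have "ereal g < lundberg_exponent M X"
      using g h(2) by (metis less_ereal.simps(1) less_le_trans)
    then obtain h' where h': "g < h'" "h' \<in> {h. 0 \<le> h \<and> (SUP j\<in>{1..}. exp_moment M (ereal h) (X j)) \<le> 1}"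
      unfolding lundberg_exponent_def less_Sup_iff by auto
    then show ?thesis
      using j g(1) X unfolding mem_lundberg_set_iff
      by (intro exp_moment_le_1_antimono[of _ g h']) auto
  qed
  \<comment> \<open>These exponents increase to \<open>h\<close> and stay strictly below it, as
    \<open>h\<close> is positive here. The integrands need not be monotone in \<open>n\<close> where
    \<open>X j\<close> changes sign, so Fatou's lemma is used.\<close>
  define g where "g n = h * (1 - inverse (real (Suc n)))" for n
  have g_lim: "g \<longlonglongrightarrow> h"
    using tendsto_mult[OF tendsto_const LIMSEQ_inverse_real_of_nat_add_minus[of 1], of h]
    by (simp add: g_def[abs_def])
  have g_bds: "0 \<le> g n" "g n < h" for n
    using False h(1) by (auto simp: g_def field_simps)
  have lim: "(\<lambda>n. ennreal (exp (g n * X j \<omega>))) \<longlonglongrightarrow> ennreal (exp (h * X j \<omega>))" for \<omega>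
    using g_lim by (intro tendsto_ennrealI tendsto_exp tendsto_mult tendsto_const)
  have "exp_moment M (ereal h) (X j) = (\<integral>\<^sup>+ \<omega>. liminf (\<lambda>n. ennreal (exp (g n * X j \<omega>))) \<partial>M)"
    unfolding exp_moment_ereal using lim_imp_Liminf[OF _ lim] by simp
  also have "\<dots> \<le> liminf (\<lambda>n. \<integral>\<^sup>+ \<omega>. ennreal (exp (g n * X j \<omega>)) \<partial>M)"
    by (rule nn_integral_liminf) measurable
  also have "\<dots> \<le> 1"
  proof -
    have "liminf (\<lambda>n. \<integral>\<^sup>+ \<omega>. ennreal (exp (g n * X j \<omega>)) \<partial>M) \<le> liminf (\<lambda>n. 1 :: ennreal)"
      using less[OF g_bds] by (intro Liminf_mono always_eventually) (simp add: exp_moment_ereal)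
    then show ?thesis by (simp add: Liminf_const)
  qed
  finally show ?thesis .
qed

text \<open>The exponent 0 is always admissible, so the supremum is not the -\<infinity> of an empty
  set and \<open>{0..L}\<close> contains \<open>L\<close>.\<close>

lemma (in prob_space) lundberg_exponent_nonneg: "0 \<le> lundberg_exponent M X"
proof -
  have "0 \<in> {h. 0 \<le> h \<and> (SUP j\<in>{1..}. exp_moment M (ereal h) (X j)) \<le> 1}"
    unfolding mem_lundberg_set_iff exp_moment_ereal by (simp add: emeasure_space_1)
  then show ?thesis
    unfolding lundberg_exponent_def zero_ereal_def by (intro Sup_upper imageI)
qed

text \<open>By independence the moment of a partial sum is a product of factors at most 1, so every
  exponent admissible for \<open>Y\<close> is admissible for its sums.\<close>

lemma (in prob_space) lundberg_exponent_partial_sums: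
  fixes Y :: "nat \<Rightarrow> 'a \<Rightarrow> real"
  assumes indep: "indep_vars (\<lambda>_. borel) Y {1..}"
  shows "lundberg_exponent M Y \<le> lundberg_exponent M (\<lambda>k \<omega>. \<Sum>i=1..k. Y i \<omega>)"
  unfolding lundberg_exponent_def
proof (intro Sup_subset_mono image_mono subsetI)
  fix h assume "h \<in> {h. 0 \<le> h \<and> (SUP j\<in>{1..}. exp_moment M (ereal h) (Y j)) \<le> 1}"
  then have h: "0 \<le> h" "\<And>j. 1 \<le> j \<Longrightarrow> exp_moment M (ereal h) (Y j) \<le> 1"
    unfolding mem_lundberg_set_iff by auto
  have "exp_moment M (ereal h) (\<lambda>\<omega>. \<Sum>i=1..k. Y i \<omega>) \<le> 1" for k
  proof -
    have "exp_moment M (ereal h) (\<lambda>\<omega>. \<Sum>i=1..k. Y i \<omega>) =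
        (\<integral>\<^sup>+ \<omega>. (\<Prod>i=1..k. ennreal (exp (h * Y i \<omega>))) \<partial>M)"
      by (simp add: exp_moment_ereal sum_distrib_left exp_sum prod_ennreal)
    also have "\<dots> = (\<Prod>i=1..k. \<integral>\<^sup>+ \<omega>. ennreal (exp (h * Y i \<omega>)) \<partial>M)"
      by (intro indep_vars_nn_integral indep_vars_compose2[OF indep_vars_subset[OF indep]]) auto
    also have "\<dots> \<le> (\<Prod>i=1..k. 1)"
      using h(2) by (intro prod_mono_ennreal) (auto simp: exp_moment_ereal)
    finally show ?thesis by simp
  qed
  with h(1) show "h \<in> {h. 0 \<le> h \<and> (SUP k\<in>{1..}. exp_moment M (ereal h) (\<lambda>\<omega>. \<Sum>i=1..k. Y i \<omega>)) \<le> 1}"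
    unfolding mem_lundberg_set_iff by blast
qed

theorem corollary1:
  fixes M :: "'a measure"
    and R :: "real \<Rightarrow> 'a \<Rightarrow> real"
    and T :: "nat \<Rightarrow> 'a \<Rightarrow> real"
    and u :: real
  assumes prob: "prob_space M"
    and R_measurable: "\<And>t. 0 \<le> t \<Longrightarrow> R t \<in> borel_measurable M"
    and T_measurable: "\<And>k. T k \<in> borel_measurable M"
    and u_pos: "0 < u"
    and R_initial: "AE \<omega> in M. R 0 \<omega> = u"
    and T_zero: "AE \<omega> in M. T 0 \<omega> = 0"
    and T_increasing: "AE \<omega> in M. \<forall>k. T k \<omega> < T (Suc k) \<omega>"
    and T_unbounded: "AE \<omega> in M. filterlim (\<lambda>n. T n \<omega>) at_top sequentially"
    and positive_jumps_only_at_T: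
      "AE \<omega> in M. \<forall>t>0. positive_jump (\<lambda>s. R s \<omega>) t \<longrightarrow> (\<exists>k\<ge>1. t = T k \<omega>)"
    and monotone_between_T:
      "AE \<omega> in M. \<forall>k. mono_on {T k \<omega>..<T (Suc k) \<omega>} (\<lambda>s. R s \<omega>) \<or>
                       antimono_on {T k \<omega>..<T (Suc k) \<omega>} (\<lambda>s. R s \<omega>)"
    and no_positive_jump_after_decrease:
      "AE \<omega> in M. \<forall>k. positive_jump (\<lambda>s. R s \<omega>) (T (Suc k) \<omega>) \<longrightarrow>
                       mono_on {T k \<omega>..<T (Suc k) \<omega>} (\<lambda>s. R s \<omega>)"
    and Y_indep: "prob_space.indep_vars M (\<lambda>_. borel) (loss R T) {1..}"
  shows "let L = lundberg_exponent M (loss R T);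
             b = (\<lambda>h. exp_ereal (- (h * ereal u)) * exp_moment M h (loss R T 1))
         in ennreal (ruin_prob M R u) \<le> (INF h\<in>{0..L}. b h) \<and>
            (INF h\<in>{0..L}. b h) \<le> b L \<and>
            b L \<le> exp_ereal (- (L * ereal u)) \<and>
            L \<le> lundberg_exponent M (total_loss R T)"
proof -
  interpret prob_space M by (rule prob)
  define L where "L = lundberg_exponent M (loss R T)"
  define b where "b h = exp_ereal (- (h * ereal u)) * exp_moment M h (loss R T 1)" for h
  have loss_meas: "loss R T k \<in> borel_measurable M" if "1 \<le> k" for k
    using Y_indep that unfolding indep_vars_def by auto
  have L_nonneg: "0 \<le> L" unfolding L_def by (rule lundberg_exponent_nonneg)
  have moment: "exp_moment M (ereal h) (loss R T j) \<le> 1" if "0 \<le> h" "ereal h \<le> L" "1 \<le> j" for h j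
    using that unfolding L_def by (intro exp_moment_le_1_below_lundberg loss_meas)
  have b_ereal: "b (ereal h) = ennreal (exp (- (h * u))) * exp_moment M (ereal h) (loss R T 1)" for h
    by (simp add: b_def exp_ereal_def)
  have b_le: "b (ereal h) \<le> ennreal (exp (- (h * u)))" if "0 \<le> h" "ereal h \<le> L" for h
    using mult_left_mono[OF moment[OF that, of 1], of "ennreal (exp (- (h * u)))"] by (simp add: b_ereal)
  \<comment> \<open>The first factor is \<open>exp_ereal (-\<infinity>)\<close>, that is 0, and a
    zero factor annihilates even an infinite moment in \<open>ennreal\<close>.\<close>
  have b_inf: "b \<infinity> = 0"
    using u_pos by (simp add: b_def exp_ereal_def)
  have "ennreal (ruin_prob M R u) \<le> emeasure M {\<omega> \<in> space M. \<exists>k. u < total_loss R T k \<omega>}"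
    using assms loss_meas by (intro ruin_prob_le_exceed) auto
  then have ruin_finite: "ennreal (ruin_prob M R u) \<le> b (ereal h)" if "0 \<le> h" "ereal h \<le> L" for h
    using partial_sums_exceed_le[OF Y_indep that(1), of u] moment[OF that] u_pos
    by (simp add: b_ereal total_loss_def)
  have ruin: "ennreal (ruin_prob M R u) \<le> b h" if h: "h \<in> {0..L}" for h
  proof (cases h)
    case (real r)
    with h ruin_finite show ?thesis by simp
  next
    case PInf
    with h have L: "L = \<infinity>" by simp
    \<comment> \<open>When \<open>L\<close> is infinite every natural number is an allowed exponent;
      the resulting bounds tend to 0, matching \<open>b \<infinity> = 0\<close>.\<close>
    have "(\<lambda>n. ennreal (exp (- (real n * u)))) \<longlonglongrightarrow> ennreal 0"
    proof (rule tendsto_ennrealI)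
      have "(\<lambda>n. exp (- u) ^ n) \<longlonglongrightarrow> 0"
        using u_pos by (intro LIMSEQ_realpow_zero) auto
      then show "(\<lambda>n. exp (- (real n * u))) \<longlonglongrightarrow> 0"
        by (simp flip: exp_of_nat_mult)
    qed
    moreover have "ennreal (ruin_prob M R u) \<le> ennreal (exp (- (real n * u)))" for n
      using L by (intro order_trans[OF ruin_finite b_le]) auto
    ultimately have "ennreal (ruin_prob M R u) \<le> ennreal 0"
      by (intro LIMSEQ_le_const) auto
    then show ?thesis by simp
  next
    case MInf
    with h show ?thesis by simp
  qed
  have "ennreal (ruin_prob M R u) \<le> (INF h\<in>{0..L}. b h)"
    by (intro INF_greatest ruin)
  moreover have "(INF h\<in>{0..L}. b h) \<le> b L"
    using L_nonneg by (intro INF_lower) simp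
  \<comment> \<open>A finite \<open>L\<close> is itself admissible, so \<open>b_le\<close> applies
    at \<open>L\<close>; for infinite \<open>L\<close> the left side is 0.\<close>
  moreover have "b L \<le> exp_ereal (- (L * ereal u))"
  proof (cases L)
    case (real r)
    with L_nonneg b_le[of r] show ?thesis by (simp add: exp_ereal_def)
  next
    case PInf
    then show ?thesis by (simp add: b_inf)
  next
    case MInf
    with L_nonneg show ?thesis by simp
  qed
  moreover have "L \<le> lundberg_exponent M (total_loss R T)"
    using lundberg_exponent_partial_sums[OF Y_indep] by (simp add: L_def total_loss_def[abs_def])
  ultimately show ?thesis
    unfolding Let_def L_def b_def by blast
qed

end
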